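(* Let $\varphi(z)=1+B_1z+B_2z^2+B_3z^3+\cdots$ be analytic in $\mathbb{D}$ with $B_1>0$ and $B_2\in\mathbb{R}$. Let $f(z)=z+\sum_{n\ge2}a_nz^n$ belong to $\sigma$, with inverse $F=f^{-1}$ on $\mathbb{D}$, and suppose \[1+\frac{zf''(z)}{f'(z)}\prec\varphi(z)\quad\text{and}\quad 1+\frac{wF''(w)}{F'(w)}\prec\varphi(w)\] (i.e. $f\in\mathcal{K}_\sigma(\varphi)$). Then \[|a_2|\le\min\left\{\sqrt{\frac{B_1^2+B_1+|B_2-B_1|}{6}},\ \frac{B_1}{2}\right\}\quad\text{and}\quad |a_3|\le\min\left\{\frac{B_1^2+B_1+|B_2-B_1|}{6},\ \frac{B_1(3B_1+2)}{12}\right\}.\]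
   Context: $\mathbb{D}=\{z\in\mathbb{C}:|z|<1\}$. $\mathcal{A}$ denotes the class of analytic functions $f$ on $\mathbb{D}$ with $f(0)=0$, $f'(0)=1$, i.e. $f(z)=z+\sum_{n\ge2}a_nz^n$. The class $\sigma$ of bi-univalent functions consists of those $f\in\mathcal{A}$ that are univalent in $\mathbb{D}$ and whose inverse $f^{-1}$ (defined near $0$) extends to a univalent analytic function $F$ on $\mathbb{D}$; then $F(w)=w-a_2w^2+(2a_2^2-a_3)w^3+\cdots$. For analytic $g,h$ on $\mathbb{D}$, $g\prec h$ (subordination) means there is an analytic $\omega:\mathbb{D}\to\mathbb{D}$ with $\omega(0)=0$ and $g=h\circ\omega$. *)

theory Defs
  imports "HOL-Analysis.Analysis"
begin

definition unit_disc :: "complex set" where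
  "unit_disc = ball 0 1"

definition class_A :: "(complex \<Rightarrow> complex) \<Rightarrow> bool" where
  "class_A f \<longleftrightarrow> f holomorphic_on unit_disc \<and> f 0 = 0 \<and> deriv f 0 = 1"

definition bi_univalent_with_inverse ::
  "(complex \<Rightarrow> complex) \<Rightarrow> (complex \<Rightarrow> complex) \<Rightarrow> bool" where
  "bi_univalent_with_inverse f F \<longleftrightarrow>
     class_A f \<and> inj_on f unit_disc \<and>
     F holomorphic_on unit_disc \<and> inj_on F unit_disc \<and>
     (\<forall>\<^sub>F w in nhds 0. f (F w) = w) \<and> (\<forall>\<^sub>F z in nhds 0. F (f z) = z)"

definition subordinate :: "(complex \<Rightarrow> complex) \<Rightarrow> (complex \<Rightarrow> complex) \<Rightarrow> bool" where
  "subordinate g h \<longleftrightarrow>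
     (\<exists>\<omega>. \<omega> holomorphic_on unit_disc \<and> \<omega> ` unit_disc \<subseteq> unit_disc \<and> \<omega> 0 = 0 \<and>
          (\<forall>z\<in>unit_disc. g z = h (\<omega> z)))"

definition taylor_coeff :: "(complex \<Rightarrow> complex) \<Rightarrow> nat \<Rightarrow> complex" where
  "taylor_coeff f n = (deriv ^^ n) f 0 / of_nat (fact n)"

end

theory Submission
  imports Defs "HOL-Complex_Analysis.Complex_Analysis"
begin

text \<open>
  Let \<open>u\<close> and \<open>v\<close> be the Schwarz functions of the two subordinations. Comparing
  coefficients in the subordinations, where the inverse has coefficients \<open>-a2\<close> and
  \<open>2 a2^2 - a3\<close>, gives
  \<open>2 a2 = B1 u1 = - B1 v1\<close>, \<open>6 a3 - 4 a2^2 = B1 u2 + B2 u1^2\<close> and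
  \<open>8 a2^2 - 6 a3 = B1 v2 + B2 v1^2\<close>. The sum of the last two equations gives the first bound
  on \<open>a2\<close>, their difference the second bound on \<open>a3\<close>, and the equation for \<open>f\<close> alone the first
  bound on \<open>a3\<close>. The inequality \<open>|u2| \<le> 1 - |u1|^2\<close> (rather than just \<open>|u2| \<le> 1\<close>) is what
  makes the estimates interpolate linearly in \<open>t = |u1|^2\<close>.
\<close>

text \<open>The Moebius map taking \<open>h 0\<close> to 0 turns \<open>h\<close> into a self-map of
  the disc fixing 0, whose derivative at 0 the Schwarz lemma bounds by 1.\<close>

lemma Schwarz_Pick_deriv_0:
  assumes hol: "h holomorphic_on ball 0 1"
    and lt1: "\<And>z. norm z < 1 \<Longrightarrow> norm (h z) < 1"
  shows "norm (deriv h 0) \<le> 1 - (norm (h 0))\<^sup>2"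
proof -
  define a where "a = h 0"
  define g where "g = Moebius_function 0 a \<circ> h"
  have a: "norm a < 1"
    using lt1[of 0] by (simp add: a_def)
  have "g holomorphic_on ball 0 1"
    unfolding g_def
    by (rule holomorphic_on_compose_gen[OF hol Moebius_function_holomorphic[OF a]])
       (use lt1 in auto)
  moreover have "g 0 = 0"
    by (simp add: g_def a_def Moebius_function_eq_zero)
  moreover have "norm (g z) < 1" if "norm z < 1" for z
    using Moebius_function_norm_lt_1[OF a lt1[OF that]] by (simp add: g_def)
  ultimately have g': "norm (deriv g 0) \<le> 1"
    using Schwarz_Lemma(2)[of g 0] by simp
  have a_sq: "1 - cnj a * a = of_real (1 - (norm a)\<^sup>2)"
    by (simp add: complex_norm_square mult.commute del: of_real_power)
  have pos: "0 < 1 - (norm a)\<^sup>2"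
    using a by (simp add: abs_square_less_1)
  have nz: "1 - cnj a * a \<noteq> 0"
    unfolding a_sq of_real_eq_0_iff using pos by simp
  have dh: "(h has_field_derivative deriv h 0) (at 0)"
    by (rule holomorphic_derivI[OF hol]) auto
  \<comment> \<open>The numerator vanishes at 0, so one term of the quotient rule survives.\<close>
  have "((\<lambda>z. (h z - a) / (1 - cnj a * h z)) has_field_derivative
          deriv h 0 / (1 - cnj a * a)) (at 0)"
    by (rule derivative_eq_intros dh refl | use nz in \<open>simp add: a_def\<close>)+
  then have "deriv g 0 = deriv h 0 / (1 - cnj a * a)"
    by (intro DERIV_imp_deriv) (simp add: g_def o_def Moebius_function_simple)
  also have "norm \<dots> = norm (deriv h 0) / (1 - (norm a)\<^sup>2)"
    unfolding a_sq norm_divide norm_of_real using pos by simp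
  finally show ?thesis
    using g' pos by (simp add: a_def)
qed

text \<open>Together with uniqueness of expansions, this turns identities between functions near 0
  into identities between formal power series.\<close>

lemma has_fps_expansion_taylor_coeff:
  assumes "g holomorphic_on unit_disc"
  shows "g has_fps_expansion Abs_fps (taylor_coeff g)"
proof -
  have "g has_fps_expansion fps_expansion g 0"
    using assms by (intro has_fps_expansion_fps_expansion[of unit_disc]) (auto simp: unit_disc_def)
  then show ?thesis
    by (simp add: fps_expansion_def taylor_coeff_def[abs_def] of_nat_fact)
qed

lemma taylor_coeff_0: "taylor_coeff g 0 = g 0"
  and taylor_coeff_1: "taylor_coeff g (Suc 0) = deriv g 0"
  by (simp_all add: taylor_coeff_def)

text \<open>Writing \<open>u z = z * h z\<close> makes the two coefficients \<open>h 0\<close> and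
  \<open>deriv h 0\<close>, so the second bound is Schwarz-Pick for \<open>h\<close> at 0. If
  \<open>norm (h 0) = 1\<close>, then \<open>u\<close> is a rotation and its second coefficient is
  0.\<close>

lemma Schwarz_coeffs:
  assumes hol: "u holomorphic_on unit_disc"
    and im: "u ` unit_disc \<subseteq> unit_disc" and u0: "u 0 = 0"
  shows "norm (taylor_coeff u 1) \<le> 1"
    and "norm (taylor_coeff u 2) \<le> 1 - (norm (taylor_coeff u 1))\<^sup>2"
proof -
  have hol': "u holomorphic_on ball 0 1"
    using hol by (simp add: unit_disc_def)
  have lt1: "norm (u z) < 1" if "norm z < 1" for z
    using im that by (auto simp: unit_disc_def image_subset_iff)
  obtain h where h: "h holomorphic_on ball 0 1" "\<And>z. norm z < 1 \<Longrightarrow> u z = z * h z"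
    "deriv u 0 = h 0"
    using Schwarz3[OF hol' u0] by metis
  have ev: "\<forall>\<^sub>F z in nhds 0. z * h z = u z"
    using eventually_nhds_in_open[of "ball 0 1" "0::complex"]
    by (auto elim!: eventually_mono simp: h(2))
  have "h has_fps_expansion Abs_fps (taylor_coeff h)"
    using h(1) by (intro has_fps_expansion_taylor_coeff) (simp add: unit_disc_def)
  then have "(\<lambda>z. z * h z) has_fps_expansion fps_X * Abs_fps (taylor_coeff h)"
    by (intro fps_expansion_intros)
  then have "u has_fps_expansion fps_X * Abs_fps (taylor_coeff h)"
    using has_fps_expansion_cong[OF ev refl] by blast
  from fps_expansion_unique_complex[OF has_fps_expansion_taylor_coeff[OF hol] this]
  have eq: "Abs_fps (taylor_coeff u) = fps_X * Abs_fps (taylor_coeff h)" .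
  have c1: "taylor_coeff u 1 = h 0"
    by (simp add: taylor_coeff_1 h(3))
  have c2: "taylor_coeff u 2 = deriv h 0"
    using arg_cong[OF eq, of "\<lambda>F. fps_nth F 2"] by (simp add: taylor_coeff_1)
  show le: "norm (taylor_coeff u 1) \<le> 1"
    using Schwarz_Lemma(2)[OF hol' u0 lt1, of 0] by (simp add: taylor_coeff_1)
  have linear: "taylor_coeff u 1 = \<alpha>" "taylor_coeff u 2 = 0"
    if "\<forall>z. norm z < 1 \<longrightarrow> u z = \<alpha> * z" for \<alpha>
  proof -
    have ev: "\<forall>\<^sub>F z in nhds 0. \<alpha> * z = u z"
      using eventually_nhds_in_open[of "ball 0 1" "0::complex"]
      by (auto elim!: eventually_mono simp: that)
    have "(\<lambda>z. \<alpha> * z) has_fps_expansion fps_const \<alpha> * fps_X"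
      by (intro fps_expansion_intros)
    then have "u has_fps_expansion fps_const \<alpha> * fps_X"
      using has_fps_expansion_cong[OF ev refl] by blast
    from fps_expansion_unique_complex[OF has_fps_expansion_taylor_coeff[OF hol] this]
    have "taylor_coeff u n = fps_nth (fps_const \<alpha> * fps_X) n" for n
      by (metis fps_nth_Abs_fps)
    then show "taylor_coeff u 1 = \<alpha>" "taylor_coeff u 2 = 0"
      by simp_all
  qed
  \<comment> \<open>Equality at one point would make \<open>u\<close> a rotation and force
    \<open>norm (h 0) = 1\<close>; hence the strict bound that Schwarz-Pick requires.\<close>
  have h_lt: "norm (h z) < 1" if h0: "norm (h 0) < 1" and z: "norm z < 1" for z
  proof (cases "z = 0")
    case False
    have "norm (u z) \<le> norm z"
      using Schwarz_Lemma(1)[OF hol' u0 lt1] z by simp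
    moreover have "norm (u z) \<noteq> norm z"
    proof
      assume "norm (u z) = norm z"
      then obtain \<alpha> where "\<forall>z. norm z < 1 \<longrightarrow> u z = \<alpha> * z" "norm \<alpha> = 1"
        using Schwarz_Lemma(3)[OF hol' u0 lt1, of 0] False z by auto
      then show False
        using linear(1)[of \<alpha>] h0 c1 by simp
    qed
    ultimately show ?thesis
      using h(2)[OF z] False by (simp add: norm_mult)
  qed (use h0 in simp)
  show "norm (taylor_coeff u 2) \<le> 1 - (norm (taylor_coeff u 1))\<^sup>2"
  proof (cases "norm (h 0) = 1")
    case True
    then obtain \<alpha> where \<alpha>: "\<forall>z. norm z < 1 \<longrightarrow> u z = \<alpha> * z"
      using Schwarz_Lemma(3)[OF hol' u0 lt1, of 0] h(3) by auto
    show ?thesis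
      using linear(2)[OF \<alpha>] power_le_one[OF norm_ge_zero le, of 2] by simp
  next
    case False
    then have "norm (h 0) < 1"
      using le unfolding c1 by simp
    then show ?thesis
      unfolding c1 c2 using Schwarz_Pick_deriv_0[OF h(1) h_lt] by blast
  qed
qed

text \<open>Without a constant term in \<open>B\<close>, powers of \<open>B\<close> above n do not
  reach coefficient n. Order 2 serves the subordinations, order 3 the inversion of
  \<open>f\<close>.\<close>

lemma fps_compose_nth_low:
  assumes "fps_nth B 0 = (0::complex)"
  shows "fps_nth (A oo B) 0 = fps_nth A 0"
    and "fps_nth (A oo B) 1 = fps_nth A 1 * fps_nth B 1"
    and "fps_nth (A oo B) 2 = fps_nth A 1 * fps_nth B 2 + fps_nth A 2 * (fps_nth B 1)\<^sup>2"
    and "fps_nth (A oo B) 3 = fps_nth A 1 * fps_nth B 3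
           + 2 * fps_nth A 2 * fps_nth B 1 * fps_nth B 2 + fps_nth A 3 * (fps_nth B 1) ^ 3"
  using assms
  by (simp_all add: fps_compose_nth fps_mult_nth eval_nat_numeral algebra_simps)

text \<open>Multiplying the subordination by \<open>deriv g\<close> gives a power series identity
  free of division; its coefficients of orders 1 and 2 are the two equations. The form with a
  general \<open>g\<close> covers both \<open>f\<close> and \<open>F\<close>.\<close>

lemma convex_subordinate_coeffs:
  assumes phi_hol: "\<phi> holomorphic_on unit_disc" and phi0: "\<phi> 0 = 1"
    and hol: "g holomorphic_on unit_disc" and g': "deriv g 0 = 1"
    and sub: "subordinate (\<lambda>z. 1 + z * deriv (deriv g) z / deriv g z) \<phi>"
  obtains u1 u2 where "norm u1 \<le> 1" "norm u2 \<le> 1 - (norm u1)\<^sup>2"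
    "2 * taylor_coeff g 2 = taylor_coeff \<phi> 1 * u1"
    "6 * taylor_coeff g 3 = 4 * (taylor_coeff g 2)\<^sup>2
       + taylor_coeff \<phi> 1 * u2 + taylor_coeff \<phi> 2 * u1\<^sup>2"
proof -
  obtain u where u: "u holomorphic_on unit_disc" "u ` unit_disc \<subseteq> unit_disc" "u 0 = 0"
    and eq: "\<And>z. z \<in> unit_disc \<Longrightarrow> 1 + z * deriv (deriv g) z / deriv g z = \<phi> (u z)"
    using sub unfolding subordinate_def by blast
  define U where "U = Abs_fps (taylor_coeff u)"
  define P where "P = Abs_fps (taylor_coeff \<phi>)"
  define D where "D = fps_deriv (Abs_fps (taylor_coeff g))"
  have U0: "fps_nth U 0 = 0"
    by (simp add: U_def taylor_coeff_0 u)
  have D: "deriv g has_fps_expansion D"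
    unfolding D_def by (intro fps_expansion_intros has_fps_expansion_taylor_coeff hol)
  \<comment> \<open>The denominator can be cleared where \<open>deriv g\<close> is nonzero; a
    neighbourhood of 0 is enough to compare expansions.\<close>
  have "isCont (deriv g) 0"
    using D has_fps_expansion_imp_continuous by blast
  then have "\<forall>\<^sub>F z in nhds 0. deriv g z \<noteq> 0"
    using tendsto_imp_eventually_ne[of "deriv g" "deriv g 0" "at 0" 0]
    by (simp add: isCont_def eventually_nhds_conv_at g')
  moreover have "\<forall>\<^sub>F z in nhds 0. z \<in> unit_disc"
    by (intro eventually_nhds_in_open) (simp_all add: unit_disc_def)
  ultimately have ev: "\<forall>\<^sub>F z in nhds 0. deriv g z + z * deriv (deriv g) z = deriv g z * (\<phi> \<circ> u) z"
  proof eventually_elim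
    case (elim z)
    then show ?case
      using eq[of z] by (simp add: field_simps)
  qed
  have "(\<lambda>z. deriv g z + z * deriv (deriv g) z) has_fps_expansion D + fps_X * fps_deriv D"
    by (intro fps_expansion_intros D)
  moreover have "(\<lambda>z. deriv g z * (\<phi> \<circ> u) z) has_fps_expansion D * (P oo U)"
    using U0 unfolding U_def P_def
    by (intro fps_expansion_intros D has_fps_expansion_compose has_fps_expansion_taylor_coeff
        phi_hol u)
  ultimately have key: "D + fps_X * fps_deriv D = D * (P oo U)"
    using has_fps_expansion_cong[OF ev refl] fps_expansion_unique_complex by blast
  have D_nth: "fps_nth D 0 = 1" "fps_nth D 1 = 2 * taylor_coeff g 2"
    "fps_nth D 2 = 3 * taylor_coeff g 3"
    by (simp_all add: D_def taylor_coeff_1 g' eval_nat_numeral)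
  have P0: "fps_nth P 0 = 1"
    by (simp add: P_def taylor_coeff_0 phi0)
  have e1: "2 * taylor_coeff g 2 = taylor_coeff \<phi> 1 * taylor_coeff u 1"
    using arg_cong[OF key, of "\<lambda>F. fps_nth F 1"] D_nth fps_compose_nth_low[OF U0, of P] P0
    by (simp add: fps_mult_nth P_def U_def)
  \<comment> \<open>The mixed term of the product is \<open>2 * taylor_coeff g 2\<close> times the
    right side of \<open>e1\<close>, which is where \<open>4 * (taylor_coeff g 2)\<^sup>2\<close>
    comes from.\<close>
  have e2: "6 * taylor_coeff g 3 = 4 * (taylor_coeff g 2)\<^sup>2
      + taylor_coeff \<phi> 1 * taylor_coeff u 2 + taylor_coeff \<phi> 2 * (taylor_coeff u 1)\<^sup>2"
    using arg_cong[OF key, of "\<lambda>F. fps_nth F 2"] D_nth fps_compose_nth_low[OF U0, of P] P0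
      arg_cong[OF e1, of "\<lambda>x. x\<^sup>2"] e1
    by (simp add: fps_mult_nth P_def U_def numeral_2_eq_2 algebra_simps)
  show thesis
    using that[OF Schwarz_coeffs[OF u] e1 e2] .
qed

text \<open>Comparing coefficients in \<open>f (F w) = w\<close> at orders 1, 2 and 3 determines
  those of \<open>F\<close> successively.\<close>

lemma inverse_coeffs:
  assumes "bi_univalent_with_inverse f F"
  shows "deriv F 0 = 1"
    and "taylor_coeff F 2 = - taylor_coeff f 2"
    and "taylor_coeff F 3 = 2 * (taylor_coeff f 2)\<^sup>2 - taylor_coeff f 3"
proof -
  define A where "A = Abs_fps (taylor_coeff f)"
  define B where "B = Abs_fps (taylor_coeff F)"
  have f: "f holomorphic_on unit_disc" "f 0 = 0" "deriv f 0 = 1"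
    and F: "F holomorphic_on unit_disc"
    and ev: "\<forall>\<^sub>F w in nhds 0. (f \<circ> F) w = w"
    and ev': "\<forall>\<^sub>F z in nhds 0. F (f z) = z"
    using assms by (auto simp: bi_univalent_with_inverse_def class_A_def)
  \<comment> \<open>This value comes from \<open>F (f z) = z\<close> at 0; it makes composition with
    the series of \<open>F\<close> meaningful.\<close>
  have "F 0 = 0"
    using eventually_nhds_x_imp_x[OF ev'] f by simp
  then have B0: "fps_nth B 0 = 0"
    by (simp add: B_def taylor_coeff_0)
  have "(f \<circ> F) has_fps_expansion (A oo B)"
    using B0 unfolding A_def B_def
    by (intro has_fps_expansion_compose has_fps_expansion_taylor_coeff f F)
  then have "(\<lambda>w. w) has_fps_expansion (A oo B)"
    using has_fps_expansion_cong[OF ev refl] by blast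
  then have key: "A oo B = fps_X"
    using has_fps_expansion_fps_X fps_expansion_unique_complex by blast
  note nth = fps_compose_nth_low[OF B0, of A, unfolded key]
  have A1: "taylor_coeff f (Suc 0) = 1"
    by (simp add: taylor_coeff_1 f)
  show F': "deriv F 0 = 1"
    using nth(2) by (simp add: A_def B_def taylor_coeff_1 f)
  show c2: "taylor_coeff F 2 = - taylor_coeff f 2"
    using nth(3) by (simp add: A_def B_def A1 taylor_coeff_1 F' f eq_neg_iff_add_eq_0)
  show "taylor_coeff F 3 = 2 * (taylor_coeff f 2)\<^sup>2 - taylor_coeff f 3"
    using nth(4) c2
    by (simp add: A_def B_def A1 taylor_coeff_1 F' f power2_eq_square) (simp add: algebra_simps add_eq_0_iff)
qed

theorem theorem3:
  fixes \<phi> f F :: "complex \<Rightarrow> complex" and B1 B2 :: real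
  assumes phi_hol: "\<phi> holomorphic_on unit_disc"
    and phi0: "\<phi> 0 = 1"
    and B1: "taylor_coeff \<phi> 1 = complex_of_real B1" and B1_pos: "B1 > 0"
    and B2: "taylor_coeff \<phi> 2 = complex_of_real B2"
    and bi: "bi_univalent_with_inverse f F"
    and sub_f: "subordinate (\<lambda>z. 1 + z * deriv (deriv f) z / deriv f z) \<phi>"
    and sub_F: "subordinate (\<lambda>w. 1 + w * deriv (deriv F) w / deriv F w) \<phi>"
  shows "norm (taylor_coeff f 2) \<le>
           min (sqrt ((B1\<^sup>2 + B1 + \<bar>B2 - B1\<bar>) / 6)) (B1 / 2)
       \<and> norm (taylor_coeff f 3) \<le>
           min ((B1\<^sup>2 + B1 + \<bar>B2 - B1\<bar>) / 6) (B1 * (3 * B1 + 2) / 12)"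
proof -
  have hol: "f holomorphic_on unit_disc" "deriv f 0 = 1" "F holomorphic_on unit_disc"
    using bi by (auto simp: bi_univalent_with_inverse_def class_A_def)
  define a2 where "a2 = taylor_coeff f 2"
  define a3 where "a3 = taylor_coeff f 3"
  obtain u1 u2 where u: "norm u1 \<le> 1" "norm u2 \<le> 1 - (norm u1)\<^sup>2"
    "2 * a2 = of_real B1 * u1" "6 * a3 = 4 * a2\<^sup>2 + of_real B1 * u2 + of_real B2 * u1\<^sup>2"
    using convex_subordinate_coeffs[OF phi_hol phi0 hol(1,2) sub_f]
    unfolding a2_def a3_def B1 B2 by metis
  obtain v1 v2 where v: "norm v1 \<le> 1" "norm v2 \<le> 1 - (norm v1)\<^sup>2"
    "2 * (- a2) = of_real B1 * v1"
    "6 * (2 * a2\<^sup>2 - a3) = 4 * (- a2)\<^sup>2 + of_real B1 * v2 + of_real B2 * v1\<^sup>2"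
    using convex_subordinate_coeffs[OF phi_hol phi0 hol(3) inverse_coeffs(1)[OF bi] sub_F]
    unfolding inverse_coeffs(2,3)[OF bi] a2_def[symmetric] a3_def[symmetric] B1 B2 by metis
  \<comment> \<open>Both first-order equations determine \<open>a2\<close>, so a single parameter
    \<open>t\<close> controls both Schwarz functions.\<close>
  have "of_real B1 * v1 = of_real B1 * (- u1)"
    using u(3) v(3) by (simp add: algebra_simps)
  then have v1: "v1 = - u1"
    using B1_pos by (simp only: mult_cancel_left) simp
  define t where "t = (norm u1)\<^sup>2"
  have t: "0 \<le> t" "t \<le> 1"
    using u(1) by (simp_all add: t_def power_le_one)
  have n2: "norm u2 \<le> 1 - t" "norm v2 \<le> 1 - t"
    using u(2) v(2) by (simp_all add: t_def v1)
  have a2_norm: "2 * norm a2 = B1 * norm u1"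
    using arg_cong[OF u(3), of norm] B1_pos by (simp add: norm_mult)
  have a2_sq: "4 * (norm a2)\<^sup>2 = B1\<^sup>2 * t"
    using arg_cong[OF a2_norm, of "\<lambda>x. x\<^sup>2"] by (simp add: power_mult_distrib t_def)
  have a2n: "norm (4 * a2\<^sup>2) = B1\<^sup>2 * t" and a2n': "norm (12 * a2\<^sup>2) = 3 * (B1\<^sup>2 * t)"
    using a2_sq by (simp_all add: norm_mult norm_power)
  have B1n: "norm (of_real B1 * w) \<le> B1 * (1 - t)" if "norm w \<le> 1 - t" for w :: complex
    using that B1_pos by (simp add: norm_mult)
  have B2n: "norm (of_real B2 * u1\<^sup>2) = \<bar>B2\<bar> * t"
    by (simp add: norm_mult norm_power t_def)
  define M where "M = B1\<^sup>2 + B1 + \<bar>B2 - B1\<bar>"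
  \<comment> \<open>By the triangle inequality \<open>\<bar>B2\<bar>\<close> is at most
    \<open>B1 + \<bar>B2 - B1\<bar>\<close>, and its share \<open>B1 * t\<close> completes
    \<open>B1 * (1 - t)\<close> to \<open>B1\<close>. The same bound serves \<open>a2\<close> and
    \<open>a3\<close>.\<close>
  have M: "B1\<^sup>2 * t + B1 * (1 - t) + \<bar>B2\<bar> * t \<le> M"
  proof -
    have "\<bar>B2\<bar> * t \<le> (B1 + \<bar>B2 - B1\<bar>) * t"
      using t B1_pos by (intro mult_right_mono) auto
    moreover have "B1\<^sup>2 * t \<le> B1\<^sup>2" "\<bar>B2 - B1\<bar> * t \<le> \<bar>B2 - B1\<bar>"
      using t by (simp_all add: mult_left_le)
    ultimately show ?thesis
      by (simp add: M_def algebra_simps)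
  qed
  have "4 * a2\<^sup>2 = of_real B1 * u2 + of_real B1 * v2 + 2 * (of_real B2 * u1\<^sup>2)"
    using u(4) v(4) by (simp add: v1 algebra_simps)
  then have "4 * (norm a2)\<^sup>2 = norm (of_real B1 * u2 + of_real B1 * v2 + 2 * (of_real B2 * u1\<^sup>2))"
    by (metis norm_mult norm_numeral norm_power)
  also have "\<dots> \<le> norm (of_real B1 * u2) + norm (of_real B1 * v2) + 2 * norm (of_real B2 * u1\<^sup>2)"
    by (metis norm_triangle_le norm_triangle_ineq add_right_mono norm_mult norm_numeral)
  also have "\<dots> \<le> 2 * (B1 * (1 - t)) + 2 * (\<bar>B2\<bar> * t)"
    using B1n[OF n2(1)] B1n[OF n2(2)] B2n by simp
  \<comment> \<open>Half of the estimate bounds \<open>2 * (norm a2)\<^sup>2\<close>; adding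
    \<open>4 * (norm a2)\<^sup>2 = B1\<^sup>2 * t\<close> produces the factor 6 and the left side of
    \<open>M\<close>.\<close>
  finally have "6 * (norm a2)\<^sup>2 \<le> M"
    using a2_sq M by linarith
  then have a2_M: "norm a2 \<le> sqrt (M / 6)"
    by (intro real_le_rsqrt) simp
  have a2_B1: "norm a2 \<le> B1 / 2"
    using a2_norm mult_left_le[OF u(1) less_imp_le[OF B1_pos]] by linarith
  have "6 * norm a3 = norm (4 * a2\<^sup>2 + of_real B1 * u2 + of_real B2 * u1\<^sup>2)"
    using arg_cong[OF u(4), of norm] by (simp add: norm_mult)
  also have "\<dots> \<le> norm (4 * a2\<^sup>2) + norm (of_real B1 * u2) + norm (of_real B2 * u1\<^sup>2)"
    by (meson norm_triangle_le norm_triangle_ineq add_right_mono)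
  also have "\<dots> \<le> B1\<^sup>2 * t + B1 * (1 - t) + \<bar>B2\<bar> * t"
    using B1n[OF n2(1)] B2n a2n by linarith
  finally have a3_M: "norm a3 \<le> M / 6"
    using M by simp
  \<comment> \<open>The \<open>B2\<close> terms cancel because \<open>v1 = - u1\<close>, so the
    resulting bound involves \<open>B1\<close> alone.\<close>
  have "12 * a3 = 12 * a2\<^sup>2 + of_real B1 * u2 - of_real B1 * v2"
    using u(4) v(4) unfolding v1 power2_minus by algebra
  then have "12 * norm a3 = norm (12 * a2\<^sup>2 + of_real B1 * u2 - of_real B1 * v2)"
    by (metis norm_mult norm_numeral)
  also have "\<dots> \<le> norm (12 * a2\<^sup>2) + norm (of_real B1 * u2) + norm (of_real B1 * v2)"
    by (meson norm_triangle_le_diff norm_triangle_ineq norm_triangle_ineq4 order_trans add_right_mono)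
  also have "\<dots> \<le> 3 * (B1\<^sup>2 * t) + 2 * (B1 * (1 - t))"
    using B1n[OF n2(1)] B1n[OF n2(2)] a2n a2n' by linarith
  \<comment> \<open>The summands are bounded separately, by \<open>t \<le> 1\<close> and
    \<open>1 - t \<le> 1\<close>, which gives a sum rather than a maximum.\<close>
  also have "\<dots> \<le> 3 * B1\<^sup>2 + 2 * B1"
    using t B1_pos by (intro add_mono mult_left_mono mult_left_le) auto
  finally have a3_B1: "norm a3 \<le> B1 * (3 * B1 + 2) / 12"
    by (simp add: power2_eq_square algebra_simps)
  show ?thesis
    using a2_M a2_B1 a3_M a3_B1 by (simp add: a2_def a3_def M_def)
qed

end
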